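(* Let $N,M\ge 1$ be integers, let $\varepsilon\ge 0$, and suppose a group of $N$ users, one of whom is an auditor knowing the true value $x$, takes part in the $M$-round protocol described in the context with an $\varepsilon$-sender-anonymous service. Then for every adversary, the probability $p_{\mathrm{decep}}$ of deceiving any (i.e. at least one) member of the group without detection satisfies $$p_{\mathrm{decep}}\le\frac{N-1}{N^M}(1+\varepsilon)^M .$$
   Context: Notation: $\mathbb Z_N=\{0,\dots,N-1\}$; $\mathrm{Bij}(A\to B)$ is the set of bijections from $A$ to $B$. Anonymized access. Let $\mathcal U$ be the set of $N$ users. A leakage map $\mathcal L$ is a fixed, possibly randomized, map taking each bijection $\mathcal U\to\mathbb Z_N$ to leaked information in a countable set (if randomized, it uses fresh independent randomness at every use). In one round of anonymous requests, all $N$ users make identical simultaneous requests: a bijection $R_I$ is drawn uniformly from $\mathrm{Bij}(\mathcal U\to\mathbb Z_N)$, independently of all previous rounds; the adversary (the possibly malicious service, arbitrary, stateful and possibly randomized) is given $\mathcal L(R_I)$ and outputs a response function $R_V:\mathbb Z_N\to\{0,1\}^*$; user $u$ receives $R_V(R_I(u))$. After the round, $(R_I,R_V)$ is appended to the adversary's state, so later behaviour may depend on it. Sender anonymity. Experiment $\mathrm{EXP\text{-}SA}_{\mathcal L,\mathcal U,M}(\mathcal A)$: run $M-1$ rounds of anonymous requests (in each, a bijection is drawn uniformly from $\mathrm{Bij}(\mathcal U\to\mathbb Z_N)$ independently of all previous rounds, the adversary $\mathcal A$ is given the leakage of that bijection and outputs a response function, and the bijection and response function are then appended to its state), then an $M$-th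 round of anonymous requests with mapping $R_I$, drawn in the same way; then the adversary $\mathcal A$, knowing $\mathcal U$, $\mathcal L$, its state (from the first $M-1$ rounds) and the leakage of the $M$-th round, outputs a guess $\hat R\in\mathrm{Bij}(\mathcal U\to\mathbb Z_N)$. The experiment returns $1$ if $\hat R=R_I$ and $0$ otherwise. The service with its anonymizer is $\varepsilon$-sender-anonymous ($\varepsilon\ge0$) if for all adversaries $\mathcal A$, $\Pr[\mathrm{EXP\text{-}SA}_{\mathcal L,\mathcal U,M}(\mathcal A)=1]\le\frac{1}{N!}(1+\varepsilon)$. Protocol and detection: the $N$ users perform $M$ rounds of anonymous requests. A user detects misbehaviour if its $M$ responses are not all identical; the auditor moreover detects misbehaviour if it ever receives a value other than $x$. "Deceiving a member without detection" is the event that no user detects misbehaviour (every user receives $M$ identical responses and the auditor receives $x$ in every round) while at least one user accepts (receives in all $M$ rounds) a value different from $x$. *)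

theory Defs
  imports "HOL-Probability.Probability"
begin

text \<open>
  The positions \<open>\<int>\<^sub>N\<close> are \<open>{..<N}\<close> with \<open>N = card U\<close>. Bijections are taken extensional
  outside \<open>U\<close>, so that there are exactly \<open>N!\<close> of them and equality of bijections is
  equality of HOL functions.
\<close>

definition position_maps :: "'u set \<Rightarrow> ('u \<Rightarrow> nat) set" where
  "position_maps U = {R \<in> U \<rightarrow>\<^sub>E {..<card U}. bij_betw R U {..<card U}}"

type_synonym bitstring = "bool list"

text \<open>Only the values of a response function on \<open>{..<N}\<close> are ever delivered to users.\<close>

type_synonym response = "nat \<Rightarrow> bitstring"

type_synonym 'u transcript = "(('u \<Rightarrow> nat) \<times> response) list"

text \<open>
  The state of an adversary consists of a private part of type \<open>'s\<close>, which it updates itself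
  whenever it answers (and in which it may record leakage and random choices), and of the
  transcript of all completed rounds, which is appended to by the experiment.
\<close>

record ('s, 'u, 'l) adversary =
  init :: "'s pmf"
  respond :: "'s \<Rightarrow> 'u transcript \<Rightarrow> 'l \<Rightarrow> (response \<times> 's) pmf"

text \<open>
  A guess is not forced to lie in \<^term>\<open>position_maps U\<close>; a guess outside never wins.
\<close>

record ('s, 'u, 'l) sa_adversary = "('s, 'u, 'l) adversary" +
  guess :: "'s \<Rightarrow> 'u transcript \<Rightarrow> 'l \<Rightarrow> ('u \<Rightarrow> nat) pmf"

text \<open>
  A leakage map is a kernel \<open>L\<close> into \<^typ>\<open>'l pmf\<close>, sampled afresh in every round; a
  deterministic leakage map \<open>f\<close> is \<open>\<lambda>R. return_pmf (f R)\<close>.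
\<close>

primrec run_rounds ::
  "'u set \<Rightarrow> (('u \<Rightarrow> nat) \<Rightarrow> 'l pmf) \<Rightarrow> ('s, 'u, 'l, 'z) adversary_scheme \<Rightarrow> nat
    \<Rightarrow> ('s \<times> 'u transcript) pmf" where
  "run_rounds U L A 0 = map_pmf (\<lambda>s. (s, [])) (init A)"
| "run_rounds U L A (Suc m) = do {
     (s, h) \<leftarrow> run_rounds U L A m;
     RI \<leftarrow> pmf_of_set (position_maps U);
     l \<leftarrow> L RI;
     (RV, s') \<leftarrow> respond A s h l;
     return_pmf (s', h @ [(RI, RV)])
   }"

definition exp_SA ::
  "(('u \<Rightarrow> nat) \<Rightarrow> 'l pmf) \<Rightarrow> 'u set \<Rightarrow> nat \<Rightarrow> ('s, 'u, 'l) sa_adversary \<Rightarrow> bool pmf" where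
  "exp_SA L U M A = do {
     (s, h) \<leftarrow> run_rounds U L A (M - 1);
     RI \<leftarrow> pmf_of_set (position_maps U);
     l \<leftarrow> L RI;
     R \<leftarrow> guess A s h l;
     return_pmf (R = RI)
   }"

text \<open>
  HOL cannot quantify over types inside a formula, so the type of private adversary states
  is an explicit parameter.
\<close>

definition sender_anonymous ::
  "'s itself \<Rightarrow> (('u \<Rightarrow> nat) \<Rightarrow> 'l pmf) \<Rightarrow> 'u set \<Rightarrow> nat \<Rightarrow> real \<Rightarrow> bool" where
  "sender_anonymous _ L U M \<epsilon> \<longleftrightarrow>
     (\<forall>A :: ('s, 'u, 'l) sa_adversary.
        pmf (exp_SA L U M A) True \<le> 1 / fact (card U) * (1 + \<epsilon>))"

definition received :: "'u \<Rightarrow> ('u \<Rightarrow> nat) \<times> response \<Rightarrow> bitstring" where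
  "received u r = (case r of (RI, RV) \<Rightarrow> RV (RI u))"

definition detects :: "'u \<Rightarrow> bitstring \<Rightarrow> 'u transcript \<Rightarrow> 'u \<Rightarrow> bool" where
  "detects auditor x h u \<longleftrightarrow>
     (\<exists>r \<in> set h. \<exists>r' \<in> set h. received u r \<noteq> received u r') \<or>
     (u = auditor \<and> (\<exists>r \<in> set h. received u r \<noteq> x))"

definition accepts :: "'u transcript \<Rightarrow> 'u \<Rightarrow> bitstring \<Rightarrow> bool" where
  "accepts h u v \<longleftrightarrow> (\<forall>r \<in> set h. received u r = v)"

definition deceived_undetected :: "'u set \<Rightarrow> 'u \<Rightarrow> bitstring \<Rightarrow> 'u transcript \<Rightarrow> bool" where
  "deceived_undetected U auditor x h \<longleftrightarrow>
     (\<forall>u \<in> U. \<not> detects auditor x h u) \<and> (\<exists>u \<in> U. \<exists>v. v \<noteq> x \<and> accepts h u v)"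

definition p_decep ::
  "(('u \<Rightarrow> nat) \<Rightarrow> 'l pmf) \<Rightarrow> 'u set \<Rightarrow> nat \<Rightarrow> 'u \<Rightarrow> bitstring \<Rightarrow> ('s, 'u, 'l) adversary
    \<Rightarrow> real" where
  "p_decep L U M auditor x A =
     measure_pmf.prob (run_rounds U L A M) {(s, h). deceived_undetected U auditor x h}"

end

theory Submission imports Defs begin

text \<open>
  Let \<open>T\<close> be the set of users who receive \<open>x\<close>. Undetected deception means that \<open>T\<close> is the
  same proper subset of \<open>U\<close> containing the auditor in all rounds. An adversary who achieves an
  event of a single round that, for every response, holds for at most \<open>k\<close> bijections can guess
  the bijection by choosing uniformly among those, so sender anonymity bounds the probability of
  the event by \<open>k (1 + \<epsilon>) / N!\<close>. In the first round, the auditor has to be sent to one of the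
  at most \<open>N - 1\<close> positions answered with \<open>x\<close>, so \<open>k \<le> (N - 1) (N - 1)!\<close>. In every later round,
  \<open>T\<close> is already fixed and has to be mapped onto the set of positions answered with \<open>x\<close>, so
  \<open>k \<le> |T|! (N - |T|)! \<le> (N - 1)!\<close>.
\<close>

section \<open>Counting bijections by the image of a subset\<close>

lemma finite_bij_betw_PiE:
  "finite A \<Longrightarrow> finite B \<Longrightarrow> finite {f \<in> A \<rightarrow>\<^sub>E B. bij_betw f A B}"
  using finite_PiE[where S = A and T = "\<lambda>_. B"] by simp

lemma card_bij_betw_PiE_le:
  assumes "finite A" "finite B"
  shows "card {f \<in> A \<rightarrow>\<^sub>E B. bij_betw f A B} \<le> fact (card A)"
proof (cases "card A = card B")
  case True
  have "card {f \<in> A \<rightarrow>\<^sub>E B. bij_betw f A B} \<le> card {f \<in> A \<rightarrow>\<^sub>E B. inj_on f A}"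
    using finite_PiE[where S = A and T = "\<lambda>_. B"] assms by (intro card_mono) (auto simp: bij_betw_def)
  also have "\<dots> = fact (card A)"
    using card_inj_on_subset_funcset[OF assms, of A] True
    by (simp add: fact_prod_rev atLeast0LessThan)
  finally show ?thesis .
next
  case False
  then have "{f \<in> A \<rightarrow>\<^sub>E B. bij_betw f A B} = {}"
    using bij_betw_same_card by blast
  then show ?thesis by (simp only: card.empty zero_le)
qed

lemma finite_position_maps: "finite U \<Longrightarrow> finite (position_maps U)"
  unfolding position_maps_def by (intro finite_bij_betw_PiE) auto

lemma position_maps_nonempty:
  assumes "finite U"
  shows "position_maps U \<noteq> {}"
proof -
  obtain f where "bij_betw f U {..<card U}"
    using ex_bij_betw_finite_nat[OF assms] by (auto simp: atLeast0LessThan)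
  then have "restrict f U \<in> position_maps U"
    by (auto simp: position_maps_def bij_betw_def inj_on_def)
  then show ?thesis by blast
qed

text \<open>A map sending \<open>T\<close> onto \<open>P\<close> is determined by its restrictions
  to \<open>T\<close> and \<open>U - T\<close>, which are bijections onto \<open>P\<close> and its
  complement. No relation between \<open>card P\<close> and \<open>card T\<close> is assumed: if
  they differ, there are no such maps.\<close>

lemma card_position_maps_image_le:
  assumes "finite U" "T \<subseteq> U"
  shows "card {R \<in> position_maps U. R ` T = P} \<le> fact (card T) * fact (card (U - T))"
proof (cases "finite P")
  case True
  let ?B = "\<lambda>A B. {f \<in> A \<rightarrow>\<^sub>E B. bij_betw f A B}"
  let ?Q = "{..<card U} - P"
  have finT: "finite T" using assms finite_subset by blast
  have split: "restrict R T \<in> ?B T P \<and> restrict R (U - T) \<in> ?B (U - T) ?Q"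
    if "R \<in> position_maps U" "R ` T = P" for R
  proof -
    have bij: "bij_betw R U {..<card U}" using that by (simp add: position_maps_def)
    then have inj: "inj_on R U" and im: "R ` U = {..<card U}" by (auto simp: bij_betw_def)
    have "R ` (U - T) = ?Q"
      using inj_on_image_set_diff[OF inj, of U T] assms that im by auto
    then show ?thesis
      using that inj_on_subset[OF inj] assms(2)
      by (auto simp: bij_betw_def)
  qed
  have "inj_on (\<lambda>R. (restrict R T, restrict R (U - T))) {R \<in> position_maps U. R ` T = P}"
  proof (rule inj_onI)
    fix R R' assume R: "R \<in> {R \<in> position_maps U. R ` T = P}" "R' \<in> {R \<in> position_maps U. R ` T = P}"
      and eq: "(restrict R T, restrict R (U - T)) = (restrict R' T, restrict R' (U - T))"
    show "R = R'"
    proof (rule extensionalityI[where A = U])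
      show "R u = R' u" if "u \<in> U" for u
        using eq that by (cases "u \<in> T") (auto dest: fun_cong[where x = u])
    qed (use R in \<open>auto simp: position_maps_def PiE_def\<close>)
  qed
  moreover have "(\<lambda>R. (restrict R T, restrict R (U - T))) ` {R \<in> position_maps U. R ` T = P}
      \<subseteq> ?B T P \<times> ?B (U - T) ?Q"
    using split by blast
  moreover have "finite (?B T P \<times> ?B (U - T) ?Q)"
    using finT True assms(1) by (intro finite_cartesian_product finite_bij_betw_PiE) auto
  ultimately have "card {R \<in> position_maps U. R ` T = P} \<le> card (?B T P \<times> ?B (U - T) ?Q)"
    by (rule card_inj_on_le)
  also have "\<dots> \<le> fact (card T) * fact (card (U - T))"
    unfolding card_cartesian_product
    using finT True assms by (intro mult_le_mono card_bij_betw_PiE_le) auto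
  finally show ?thesis .
next
  case False
  then have "{R \<in> position_maps U. R ` T = P} = {}"
    using assms finite_subset by blast
  then show ?thesis by (simp only: card.empty zero_le)
qed

text \<open>This is t! (n - t)! \<le> (n - 1)! for 0 < t < n; the two \<open>Suc\<close>s express
  that both blocks are nonempty. Raising \<open>b\<close> by one multiplies the left side by
  \<open>b + 2\<close> and the right side by the larger \<open>a + b + 2\<close>.\<close>

lemma fact_mult_fact_Suc_le: "fact (Suc a) * fact (Suc b) \<le> (fact (Suc (a + b)) :: nat)"
proof (induction b)
  case (Suc b)
  have "fact (Suc a) * fact (Suc (Suc b)) = Suc (Suc b) * (fact (Suc a) * fact (Suc b) :: nat)"
    by (simp only: fact_Suc[of "Suc b"] of_nat_id mult_ac)
  also have "\<dots> \<le> Suc (Suc (a + b)) * fact (Suc (a + b))"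
    using Suc.IH by (intro mult_le_mono) auto
  also have "\<dots> = fact (Suc (a + Suc b))" by simp
  finally show ?case .
qed simp

section \<open>The users who are answered \<open>x\<close> in a round\<close>

definition recipients :: "'u set \<Rightarrow> bitstring \<Rightarrow> ('u \<Rightarrow> nat) \<times> response \<Rightarrow> 'u set" where
  "recipients U x r = {u \<in> U. received u r = x}"

text \<open>The right-hand side depends on the response alone, so a condition on who receives
  \<open>x\<close> becomes a condition on the image of a set of users.\<close>

lemma recipients_image:
  assumes "R \<in> position_maps U"
  shows "R ` recipients U x (R, RV) = {i \<in> {..<card U}. RV i = x}"
proof -
  have im: "{..<card U} = R ` U" using assms by (auto simp: position_maps_def bij_betw_def)
  show ?thesis unfolding im by (auto simp: recipients_def received_def)
qed

text \<open>The count for the later rounds, where \<open>T\<close> is fixed by the past.\<close>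

lemma card_recipients_eq_le:
  assumes "finite U" "T \<subset> U" "T \<noteq> {}"
  shows "card {R \<in> position_maps U. recipients U x (R, RV) = T} \<le> fact (card U - 1)"
proof -
  have finT: "finite T" using assms finite_subset by blast
  have "card {R \<in> position_maps U. recipients U x (R, RV) = T}
      \<le> card {R \<in> position_maps U. R ` T = {i \<in> {..<card U}. RV i = x}}"
  proof (rule card_mono)
    show "finite {R \<in> position_maps U. R ` T = {i \<in> {..<card U}. RV i = x}}"
      using finite_position_maps[OF assms(1)] by simp
    show "{R \<in> position_maps U. recipients U x (R, RV) = T}
        \<subseteq> {R \<in> position_maps U. R ` T = {i \<in> {..<card U}. RV i = x}}"
      using recipients_image by blast
  qed
  also have "\<dots> \<le> fact (card T) * fact (card (U - T))"
    using assms by (intro card_position_maps_image_le) auto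
  also have "\<dots> \<le> fact (card U - 1)"
  proof -
    obtain a where a: "card T = Suc a"
      using assms finT by (metis card_eq_0_iff not0_implies_Suc)
    obtain b where b: "card (U - T) = Suc b"
      using assms by (metis Diff_eq_empty_iff card_eq_0_iff finite_Diff not0_implies_Suc psubsetE)
    have "card U = card T + card (U - T)"
      using assms card_mono[of U T] by (auto simp: card_Diff_subset finT)
    then have "card U - 1 = Suc (a + b)" using a b by simp
    then show ?thesis using fact_mult_fact_Suc_le[of a b] a b by (simp only:)
  qed
  finally show ?thesis .
qed

text \<open>The count for the first round, where only membership of the auditor \<open>a\<close> is
  prescribed.\<close>

lemma card_mem_recipients_le:
  assumes "finite U" "a \<in> U"
  shows "card {R \<in> position_maps U. a \<in> recipients U x (R, RV) \<and> recipients U x (R, RV) \<noteq> U}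
    \<le> (card U - 1) * fact (card U - 1)"
proof -
  define P where "P = {i \<in> {..<card U}. RV i = x}"
  let ?S = "{R \<in> position_maps U. a \<in> recipients U x (R, RV) \<and> recipients U x (R, RV) \<noteq> U}"
  show ?thesis
  proof (cases "?S = {}")
    case False
    \<comment> \<open>One such map suffices to bound \<open>card P\<close>, since \<open>P\<close>
      depends only on \<open>RV\<close>.\<close>
    then obtain R where R: "R \<in> position_maps U" "recipients U x (R, RV) \<noteq> U" by blast
    have bij: "bij_betw R U {..<card U}" using R by (simp add: position_maps_def)
    have "recipients U x (R, RV) \<subset> U" using R by (auto simp: recipients_def)
    then have "card (recipients U x (R, RV)) < card U"
      using assms psubset_card_mono by blast
    moreover have "card P = card (recipients U x (R, RV))"
      unfolding P_def recipients_image[OF R(1), symmetric]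
      using bij by (intro card_image) (auto simp: bij_betw_def recipients_def intro: inj_on_subset)
    ultimately have cardP: "card P \<le> card U - 1" by linarith
    have "?S \<subseteq> (\<Union>i\<in>P. {R \<in> position_maps U. R ` {a} = {i}})"
      using recipients_image[of _ U x RV] by (fastforce simp: P_def)
    then have "card ?S \<le> card (\<Union>i\<in>P. {R \<in> position_maps U. R ` {a} = {i}})"
      using finite_position_maps[OF assms(1)] by (intro card_mono) (auto simp: P_def)
    also have "\<dots> \<le> (\<Sum>i\<in>P. card {R \<in> position_maps U. R ` {a} = {i}})"
      by (rule card_UN_le) (simp add: P_def)
    also have "\<dots> \<le> (\<Sum>i\<in>P. fact (card U - 1))"
    proof (rule sum_mono)
      fix i
      show "card {R \<in> position_maps U. R ` {a} = {i}} \<le> fact (card U - 1)"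
        using card_position_maps_image_le[OF assms(1), of "{a}" "{i}"] assms(2)
        by (simp del: image_insert image_empty add: card_Diff_singleton)
    qed
    also have "\<dots> \<le> (card U - 1) * fact (card U - 1)"
      using cardP by simp
    finally show ?thesis .
  qed (simp only: card.empty zero_le)
qed

section \<open>From sender anonymity to events of a single round\<close>

lemma measure_bind_pmf_le:
  assumes "\<And>y. y \<in> set_pmf p \<Longrightarrow> measure_pmf.prob (f y) B \<le> c * indicator A y" "c \<ge> 0"
  shows "measure_pmf.prob (bind_pmf p f) B \<le> c * measure_pmf.prob p A"
proof -
  have "ennreal (measure_pmf.prob (bind_pmf p f) B) = (\<integral>\<^sup>+y. measure_pmf.prob (f y) B \<partial>p)"
    by (simp add: measure_pmf.emeasure_eq_measure[symmetric])
  also have "\<dots> \<le> (\<integral>\<^sup>+y. ennreal c * indicator A y \<partial>p)"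
  proof (intro nn_integral_mono_AE AE_pmfI)
    fix y assume "y \<in> set_pmf p"
    from assms(1)[OF this] show "ennreal (measure_pmf.prob (f y) B) \<le> ennreal c * indicator A y"
      by (cases "y \<in> A") (auto intro: ennreal_leI simp: measure_le_0_iff)
  qed
  also have "\<dots> = ennreal (c * measure_pmf.prob p A)"
    using assms(2) by (simp add: nn_integral_cmult_indicator measure_pmf.emeasure_eq_measure ennreal_mult)
  finally show ?thesis using assms(2) by simp
qed

text \<open>Private state and transcript are absorbed into \<open>q\<close>. The type
  \<open>'r\<close> stays open so that an answer can be a response paired with the next private
  state.\<close>

definition round_pmf ::
  "'u set \<Rightarrow> (('u \<Rightarrow> nat) \<Rightarrow> 'l pmf) \<Rightarrow> ('l \<Rightarrow> 'r pmf) \<Rightarrow> (('u \<Rightarrow> nat) \<times> 'r) pmf" where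
  "round_pmf U L q = do {
     R \<leftarrow> pmf_of_set (position_maps U);
     l \<leftarrow> L R;
     y \<leftarrow> q l;
     return_pmf (R, y)
   }"

lemma run_rounds_Suc_eq:
  "run_rounds U L A (Suc m) = run_rounds U L A m \<bind> (\<lambda>(s, h).
     map_pmf (\<lambda>(R, RV, s'). (s', h @ [(R, RV)])) (round_pmf U L (respond A s h)))"
  by (simp add: round_pmf_def map_bind_pmf case_prod_unfold)

text \<open>The guesser \<open>B\<close> passes the leakage of the challenge round to
  \<open>q\<close> and guesses uniformly among the maps satisfying \<open>Q\<close> for the answer
  \<open>y\<close>. Whenever \<open>Q\<close> holds, this guess is correct with probability at least
  1/k. Since \<open>q\<close> already contains the past of the attacked run, \<open>B\<close> need
  not simulate it, and its own earlier rounds are dummies.\<close>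

lemma sender_anonymous_round_le:
  fixes L :: "('u \<Rightarrow> nat) \<Rightarrow> 'l pmf"
  assumes "sender_anonymous TYPE('s) L U M \<epsilon>" "finite U"
    and k: "\<And>y. card {R \<in> position_maps U. Q R y} \<le> k"
  shows "measure_pmf.prob (round_pmf U L q) {(R, y). Q R y} \<le> real k * ((1 + \<epsilon>) / fact (card U))"
proof -
  let ?S = "\<lambda>y. {R \<in> position_maps U. Q R y}"
  let ?U = "pmf_of_set (position_maps U)"
  define B :: "('s, 'u, 'l) sa_adversary" where
    "B = \<lparr>init = return_pmf undefined, respond = (\<lambda>_ _ _. return_pmf undefined),
      guess = (\<lambda>_ _ l. q l \<bind> (\<lambda>y. pmf_of_set (?S y)))\<rparr>"
  have set_U: "set_pmf ?U = position_maps U"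
    using assms(2) by (intro set_pmf_of_set position_maps_nonempty finite_position_maps)
  have finS: "finite (?S y)" for y
    using finite_position_maps[OF assms(2)] by simp
  \<comment> \<open>If \<open>?S y\<close> is empty, \<open>pmf_of_set\<close> is unspecified, but
    then the left side is 0.\<close>
  have guess: "indicator {(R, y). Q R y} (R, y) \<le> real k * pmf (pmf_of_set (?S y)) R"
    if "R \<in> position_maps U" for R y
  proof (cases "Q R y")
    case True
    then have ne: "?S y \<noteq> {}" using that by blast
    then have "card (?S y) > 0" using finS by (simp add: card_gt_0_iff)
    then show ?thesis
      using True that k[of y] by (simp add: pmf_of_set[OF ne finS] field_simps)
  qed simp
  \<comment> \<open>The first \<open>M - 1\<close> rounds vanish because the guess ignores their
    outcome.\<close>
  have exp: "exp_SA L U M B =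
      ?U \<bind> (\<lambda>R. L R \<bind> (\<lambda>l. q l \<bind> (\<lambda>y. map_pmf (\<lambda>R'. R' = R) (pmf_of_set (?S y)))))"
    by (simp add: exp_SA_def B_def case_prod_unfold bind_assoc_pmf map_pmf_def)
  have "ennreal (measure_pmf.prob (round_pmf U L q) {(R, y). Q R y}) =
      (\<integral>\<^sup>+R. \<integral>\<^sup>+l. \<integral>\<^sup>+y. indicator {(R, y). Q R y} (R, y) \<partial>q l \<partial>L R \<partial>?U)"
    by (simp add: round_pmf_def measure_pmf.emeasure_eq_measure[symmetric])
  also have "\<dots> \<le> (\<integral>\<^sup>+R. \<integral>\<^sup>+l. \<integral>\<^sup>+y. ennreal k * pmf (pmf_of_set (?S y)) R \<partial>q l \<partial>L R \<partial>?U)"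
  proof (intro nn_integral_mono_AE AE_pmfI nn_integral_mono)
    fix R y assume "R \<in> set_pmf ?U"
    then show "indicator {(R, y). Q R y} (R, y) \<le> ennreal k * pmf (pmf_of_set (?S y)) R"
      using guess[of R y] set_U
      by (auto simp: indicator_def ennreal_mult[symmetric] simp flip: ennreal_1)
  qed
  also have "\<dots> = ennreal k * (\<integral>\<^sup>+R. \<integral>\<^sup>+l. \<integral>\<^sup>+y. pmf (pmf_of_set (?S y)) R \<partial>q l \<partial>L R \<partial>?U)"
    by (simp add: nn_integral_cmult)
  also have "(\<integral>\<^sup>+R. \<integral>\<^sup>+l. \<integral>\<^sup>+y. pmf (pmf_of_set (?S y)) R \<partial>q l \<partial>L R \<partial>?U) = pmf (exp_SA L U M B) True"
    by (simp add: exp ennreal_pmf_bind pmf_map vimage_def measure_pmf_single)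
  finally have "measure_pmf.prob (round_pmf U L q) {(R, y). Q R y} \<le> real k * pmf (exp_SA L U M B) True"
    by (simp add: ennreal_mult[symmetric])
  also have "\<dots> \<le> real k * ((1 + \<epsilon>) / fact (card U))"
    using assms(1) by (intro mult_left_mono) (auto simp: sender_anonymous_def)
  finally show ?thesis .
qed

section \<open>Induction over the rounds\<close>

definition constant_recipients :: "'u set \<Rightarrow> 'u \<Rightarrow> bitstring \<Rightarrow> 'u transcript \<Rightarrow> bool" where
  "constant_recipients U a x h \<longleftrightarrow>
     (\<exists>T. a \<in> T \<and> T \<subset> U \<and> (\<forall>r\<in>set h. recipients U x r = T))"

text \<open>Any round supplies the witness \<open>T\<close>. The conclusion is weaker than
  deception, as users outside \<open>T\<close> may receive varying values. On an empty transcript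
  \<open>accepts\<close> is vacuous, and the claim would fail for \<open>U = {a}\<close>.\<close>

lemma deceived_undetected_imp_constant_recipients:
  assumes "deceived_undetected U a x h" "a \<in> U" "h \<noteq> []"
  shows "constant_recipients U a x h"
proof -
  obtain r where r: "r \<in> set h" using assms(3) by (cases h) auto
  have same: "received u r' = received u r" if "u \<in> U" "r' \<in> set h" for u r'
    using assms(1) that r unfolding deceived_undetected_def detects_def by blast
  have "received a r = x"
    using assms(1,2) r unfolding deceived_undetected_def detects_def by blast
  then have "a \<in> recipients U x r"
    using assms(2) by (simp add: recipients_def)
  moreover have "recipients U x r \<subset> U"
    using assms(1) r by (fastforce simp: deceived_undetected_def accepts_def recipients_def)
  moreover have "recipients U x r' = recipients U x r" if "r' \<in> set h" for r'
    using same[OF _ that] unfolding recipients_def by (intro Collect_cong) auto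
  ultimately show ?thesis
    unfolding constant_recipients_def by blast
qed

text \<open>The number of rounds is decoupled from \<open>M\<close>, so that it can vary in the
  induction. The base case is one round: there \<open>T\<close> is still free, which costs the
  factor \<open>card U - 1\<close>; each later round contributes (1 + \<epsilon>)/N.\<close>

lemma prob_constant_recipients_le:
  fixes L :: "('u \<Rightarrow> nat) \<Rightarrow> 'l pmf" and A :: "('s, 'u, 'l) adversary"
  assumes SA: "sender_anonymous TYPE('s) L U M \<epsilon>" and fin: "finite U" and a: "a \<in> U"
    and eps: "\<epsilon> \<ge> 0"
  shows "measure_pmf.prob (run_rounds U L A (Suc m)) {(s, h). constant_recipients U a x h}
    \<le> (real (card U) - 1) * ((1 + \<epsilon>) / card U) ^ Suc m"
proof -
  let ?E = "{(s, h). constant_recipients U a x h}"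
  let ?N = "card U"
  have N: "?N > 0" using fin a by (auto simp: card_gt_0_iff)
  have fact_N: "fact ?N = real ?N * fact (?N - 1)"
    using N by (simp add: fact_reduce)
  have step: "measure_pmf.prob (map_pmf (\<lambda>(R, RV, s'). (s', h @ [(R, RV)])) (round_pmf U L (respond A s h))) ?E
      \<le> real k * ((1 + \<epsilon>) / fact ?N)"
    if "\<And>RV. card {R \<in> position_maps U. constant_recipients U a x (h @ [(R, RV)])} \<le> k" for s h k
  proof -
    have eq: "(\<lambda>(R, RV, s'). (s', h @ [(R, RV)])) -` ?E
        = {(R, y). constant_recipients U a x (h @ [(R, fst y)])}" by auto
    show ?thesis
      unfolding measure_map_pmf eq by (rule sender_anonymous_round_le[OF SA fin that])
  qed
  show ?thesis
  proof (induction m)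
    case 0
    let ?c = "(real ?N - 1) * ((1 + \<epsilon>) / ?N)"
    have "measure_pmf.prob (run_rounds U L A (Suc 0)) ?E \<le> ?c * measure_pmf.prob (init A) UNIV"
      unfolding run_rounds_Suc_eq run_rounds.simps(1) bind_map_pmf prod.case
    proof (rule measure_bind_pmf_le)
      fix s
      have "card {R \<in> position_maps U. constant_recipients U a x ([] @ [(R, RV)])}
          \<le> (?N - 1) * fact (?N - 1)" for RV
      proof (rule le_trans[OF card_mono card_mem_recipients_le[OF fin a]])
        show "{R \<in> position_maps U. constant_recipients U a x ([] @ [(R, RV)])}
            \<subseteq> {R \<in> position_maps U. a \<in> recipients U x (R, RV) \<and> recipients U x (R, RV) \<noteq> U}"
          by (auto simp: constant_recipients_def)
      qed (use finite_position_maps[OF fin] in simp)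
      moreover have "real ((?N - 1) * fact (?N - 1)) * ((1 + \<epsilon>) / fact ?N) = ?c"
        using N by (simp add: fact_N of_nat_diff)
      ultimately show "measure_pmf.prob (map_pmf (\<lambda>(R, RV, s'). (s', [] @ [(R, RV)]))
          (round_pmf U L (respond A s []))) ?E \<le> ?c * indicator UNIV s"
        using step[of "[]" "(?N - 1) * fact (?N - 1)" s] by (simp only: indicator_UNIV mult_1_right)
    qed (use N eps in auto)
    then show ?case by simp
  next
    case (Suc m)
    have "measure_pmf.prob (run_rounds U L A (Suc (Suc m))) ?E
        \<le> (1 + \<epsilon>) / ?N * measure_pmf.prob (run_rounds U L A (Suc m)) ?E"
      unfolding run_rounds_Suc_eq[of U L A "Suc m"]
    proof (rule measure_bind_pmf_le)
      fix sh assume "sh \<in> set_pmf (run_rounds U L A (Suc m))"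
      then obtain s h where sh: "sh = (s, h)" and "h \<noteq> []" by auto
      show "measure_pmf.prob (case sh of (s, h) \<Rightarrow> map_pmf (\<lambda>(R, RV, s'). (s', h @ [(R, RV)]))
          (round_pmf U L (respond A s h))) ?E \<le> (1 + \<epsilon>) / ?N * indicator ?E sh"
      proof (cases "constant_recipients U a x h")
        case True
        then obtain T where T: "a \<in> T" "T \<subset> U" "\<forall>r\<in>set h. recipients U x r = T"
          by (auto simp: constant_recipients_def)
        \<comment> \<open>An earlier round forces the common set of the extended transcript to be
          this same \<open>T\<close>.\<close>
        obtain R' RV' where R': "(R', RV') \<in> set h" using \<open>h \<noteq> []\<close> by (cases h) auto
        have "card {R \<in> position_maps U. constant_recipients U a x (h @ [(R, RV)])}
            \<le> fact (?N - 1)" for RV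
        proof (rule le_trans[OF card_mono card_recipients_eq_le[OF fin T(2)]])
          show "{R \<in> position_maps U. constant_recipients U a x (h @ [(R, RV)])}
              \<subseteq> {R \<in> position_maps U. recipients U x (R, RV) = T}"
            using T(3) R' by (auto simp: constant_recipients_def)
        qed (use finite_position_maps[OF fin] T in auto)
        moreover have "real (fact (?N - 1)) * ((1 + \<epsilon>) / fact ?N) = (1 + \<epsilon>) / ?N"
          by (simp add: fact_N)
        ultimately show ?thesis
          using step[of h "fact (?N - 1)" s] True by (simp add: sh)
      next
        case False
        \<comment> \<open>A transcript without a common set cannot acquire one by extension,
          matching the zero of the indicator.\<close>
        have "\<not> constant_recipients U a x (h @ [r])" for r
          using False \<open>h \<noteq> []\<close> by (auto simp: constant_recipients_def)
        then have "measure_pmf.prob (map_pmf (\<lambda>(R, RV, s'). (s', h @ [(R, RV)]))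
            (round_pmf U L (respond A s h))) ?E = 0"
          by (simp add: vimage_def case_prod_unfold)
        then show ?thesis using eps by (simp add: sh)
      qed
    qed (use N eps in auto)
    also have "\<dots> \<le> (1 + \<epsilon>) / ?N * ((real (card U) - 1) * ((1 + \<epsilon>) / card U) ^ Suc m)"
      using Suc.IH eps by (intro mult_left_mono) auto
    finally show ?case by (simp add: mult_ac)
  qed
qed

theorem theorem5:
  fixes N M :: nat and \<epsilon> :: real
    and U :: "'u set" and auditor :: 'u and x :: bitstring
    and L :: "('u \<Rightarrow> nat) \<Rightarrow> ('l :: countable) pmf"
    and A :: "('s, 'u, 'l) adversary"
  assumes "N \<ge> 1" and "M \<ge> 1" and "\<epsilon> \<ge> 0"
    and "finite U" and "card U = N" and "auditor \<in> U"
    and "sender_anonymous TYPE('s) L U M \<epsilon>"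
  shows "p_decep L U M auditor x A \<le> (real N - 1) / real N ^ M * (1 + \<epsilon>) ^ M"
proof -
  obtain m where M: "M = Suc m" using assms(2) by (cases M) auto
  have nonempty: "h \<noteq> []" if "(s, h) \<in> set_pmf (run_rounds U L A M)" for s h
    using that by (auto simp: M)
  have "p_decep L U M auditor x A
      \<le> measure_pmf.prob (run_rounds U L A M) {(s, h). constant_recipients U auditor x h}"
    unfolding p_decep_def
    using deceived_undetected_imp_constant_recipients[OF _ assms(6)] nonempty
    by (intro measure_pmf.finite_measure_mono_AE AE_pmfI) auto
  also have "\<dots> \<le> (real N - 1) * ((1 + \<epsilon>) / N) ^ M"
    using prob_constant_recipients_le[OF assms(7,4,6,3), of A m] by (simp only: M assms(5))
  finally show ?thesis by (simp add: power_divide)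
qed

end
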